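(* Assume $|\mathcal{A}|\geq 2$ and let $n\geq 2$. Then $n$-nested trace equivalence $\sim^n_{\mathtt{T}}$ and $n$-nested simulation equivalence $\sim^n_{\mathtt{S}}$ admit no finite, ground-complete, equational axiomatisation over $\mathrm{BCCSP}_{\|}$.
   Context: Let $\mathcal{A}$ be a finite non-empty set of actions and $\mathcal{V}$ a countably infinite set of variables. $\mathrm{BCCSP}_{\|}$ terms: $t ::= \mathbf{0} \mid x \mid a.t \mid t+t \mid t \,\|\, t$ ($a\in\mathcal{A}$, $x\in\mathcal{V}$). Closed terms are processes. Transitions: $a.p \xrightarrow{a} p$; if $p \xrightarrow{a} p'$ then $p+q \xrightarrow{a} p'$, $q+p \xrightarrow{a} p'$, $p\|q \xrightarrow{a} p'\|q$, $q \| p \xrightarrow{a} q \| p'$. For $\alpha\in\mathcal{A}^*$, $p\xrightarrow{\alpha}p'$ denotes a path labelled $\alpha$. $n$-nested trace equivalence: $p\sim^0_{\mathtt{T}}q$ for all $p,q$; $p\sim^{n+1}_{\mathtt{T}}q$ iff for all $\alpha\in\mathcal{A}^*$, $p\xrightarrow{\alpha}p'$ implies $q\xrightarrow{\alpha}q'$ with $p'\sim^n_{\mathtt{T}}q'$ for some $q'$, and $q\xrightarrow{\alpha}q'$ implies $p\xrightarrow{\alpha}p'$ with $p'\sim^n_{\mathtt{T}}q'$ for some $p'$. A simulation is a relation $S$ with $pSq$, $p\xrightarrow{a}p'$ implying $q\xrightarrow{a}q'$ and $p'Sq'$ for some $q'$. $p\sqsubseteq^0_{\mathtt{S}}q$ for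 all $p,q$; $p\sqsubseteq^{n+1}_{\mathtt{S}}q$ iff $pSq$ for some simulation $S$ with $S^{-1}\subseteq\sqsubseteq^n_{\mathtt{S}}$; $\sim^n_{\mathtt{S}}={\sqsubseteq^n_{\mathtt{S}}}\cap(\sqsubseteq^n_{\mathtt{S}})^{-1}$. A finite ground-complete axiomatisation of a relation $R$ is a finite set $\mathcal{E}$ of equations between terms that is sound modulo $R$ ($\sigma(t)R\sigma(u)$ for every equation $t\approx u$ in $\mathcal{E}$ and every closed substitution $\sigma$) and such that $pRq$ implies $\mathcal{E}\vdash p\approx q$ for all closed $p,q$, where $\vdash$ denotes derivability in equational logic (reflexivity, symmetry, transitivity, substitution instances, closure under $a.\_$, $+$, $\|$). *)

theory Defs
  imports Main "HOL-Library.Countable" "HOL-Library.Infinite_Typeclass"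
begin

datatype ('a, vars: 'v) trm =
    Zero
  | Var 'v
  | Pre 'a "('a, 'v) trm"
  | Choice "('a, 'v) trm" "('a, 'v) trm"
  | Par "('a, 'v) trm" "('a, 'v) trm"

definition processes :: "('a, 'v) trm set" where
  "processes = {p. vars p = {}}"

primrec subst :: "('v \<Rightarrow> ('a, 'v) trm) \<Rightarrow> ('a, 'v) trm \<Rightarrow> ('a, 'v) trm" where
  "subst \<sigma> Zero = Zero"
| "subst \<sigma> (Var x) = \<sigma> x"
| "subst \<sigma> (Pre a t) = Pre a (subst \<sigma> t)"
| "subst \<sigma> (Choice t u) = Choice (subst \<sigma> t) (subst \<sigma> u)"
| "subst \<sigma> (Par t u) = Par (subst \<sigma> t) (subst \<sigma> u)"

text \<open>Transitions are defined on all terms (a variable has none of its own); a transition from a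
  process always leads to a process, and the behavioural relations below only relate processes.\<close>

inductive step :: "('a, 'v) trm \<Rightarrow> 'a \<Rightarrow> ('a, 'v) trm \<Rightarrow> bool" where
  pre: "step (Pre a p) a p"
| choice_left: "step p a p' \<Longrightarrow> step (Choice p q) a p'"
| choice_right: "step p a p' \<Longrightarrow> step (Choice q p) a p'"
| par_left: "step p a p' \<Longrightarrow> step (Par p q) a (Par p' q)"
| par_right: "step p a p' \<Longrightarrow> step (Par q p) a (Par q p')"

inductive path :: "('a, 'v) trm \<Rightarrow> 'a list \<Rightarrow> ('a, 'v) trm \<Rightarrow> bool" where
  empty: "path p [] p"
| cons: "step p a p' \<Longrightarrow> path p' \<alpha> p'' \<Longrightarrow> path p (a # \<alpha>) p''"

primrec nested_trace_equiv :: "nat \<Rightarrow> ('a, 'v) trm rel" where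
  "nested_trace_equiv 0 = processes \<times> processes"
| "nested_trace_equiv (Suc n) =
     {(p, q). p \<in> processes \<and> q \<in> processes \<and>
        (\<forall>\<alpha>.
          (\<forall>p'. path p \<alpha> p' \<longrightarrow> (\<exists>q'. path q \<alpha> q' \<and> (p', q') \<in> nested_trace_equiv n)) \<and>
          (\<forall>q'. path q \<alpha> q' \<longrightarrow> (\<exists>p'. path p \<alpha> p' \<and> (p', q') \<in> nested_trace_equiv n)))}"

definition simulation :: "('a, 'v) trm rel \<Rightarrow> bool" where
  "simulation S \<longleftrightarrow> S \<subseteq> processes \<times> processes \<and>
     (\<forall>p q a p'. (p, q) \<in> S \<longrightarrow> step p a p' \<longrightarrow> (\<exists>q'. step q a q' \<and> (p', q') \<in> S))"

primrec nested_sim_preorder :: "nat \<Rightarrow> ('a, 'v) trm rel" where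
  "nested_sim_preorder 0 = processes \<times> processes"
| "nested_sim_preorder (Suc n) =
     {(p, q). \<exists>S. simulation S \<and> S\<inverse> \<subseteq> nested_sim_preorder n \<and> (p, q) \<in> S}"

definition nested_sim_equiv :: "nat \<Rightarrow> ('a, 'v) trm rel" where
  "nested_sim_equiv n = nested_sim_preorder n \<inter> (nested_sim_preorder n)\<inverse>"

text \<open>A pair \<open>(t, u)\<close> in a set of axioms stands for the equation \<open>t \<approx> u\<close> between
  possibly open terms.\<close>

inductive derives :: "('a, 'v) trm rel \<Rightarrow> ('a, 'v) trm \<Rightarrow> ('a, 'v) trm \<Rightarrow> bool"
  for E :: "('a, 'v) trm rel" where
  ax: "(t, u) \<in> E \<Longrightarrow> derives E t u"
| refl: "derives E t t"
| sym: "derives E t u \<Longrightarrow> derives E u t"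
| trans: "derives E t u \<Longrightarrow> derives E u v \<Longrightarrow> derives E t v"
| inst: "derives E t u \<Longrightarrow> derives E (subst \<sigma> t) (subst \<sigma> u)"
| cong_pre: "derives E t u \<Longrightarrow> derives E (Pre a t) (Pre a u)"
| cong_choice: "derives E t u \<Longrightarrow> derives E t' u' \<Longrightarrow> derives E (Choice t t') (Choice u u')"
| cong_par: "derives E t u \<Longrightarrow> derives E t' u' \<Longrightarrow> derives E (Par t t') (Par u u')"

definition closed_subst :: "('v \<Rightarrow> ('a, 'v) trm) \<Rightarrow> bool" where
  "closed_subst \<sigma> \<longleftrightarrow> (\<forall>x. \<sigma> x \<in> processes)"

definition sound_modulo :: "('a, 'v) trm rel \<Rightarrow> ('a, 'v) trm rel \<Rightarrow> bool" where
  "sound_modulo E R \<longleftrightarrow>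
     (\<forall>(t, u) \<in> E. \<forall>\<sigma>. closed_subst \<sigma> \<longrightarrow> (subst \<sigma> t, subst \<sigma> u) \<in> R)"

definition ground_complete :: "('a, 'v) trm rel \<Rightarrow> ('a, 'v) trm rel \<Rightarrow> bool" where
  "ground_complete E R \<longleftrightarrow>
     (\<forall>p \<in> processes. \<forall>q \<in> processes. (p, q) \<in> R \<longrightarrow> derives E p q)"

definition finite_ground_complete_axiomatisation ::
    "('a, 'v) trm rel \<Rightarrow> ('a, 'v) trm rel \<Rightarrow> bool" where
  "finite_ground_complete_axiomatisation E R \<longleftrightarrow>
     finite E \<and> sound_modulo E R \<and> ground_complete E R"

end

(*
  Both equivalences, for n >= 2, preserve the set of one-step futures
  {(c, traces p') | p --c--> p'}, and equality of these sets is a congruence. They also relate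
    a || sum_{i<N} b.r_i   and   a.(0 || sum_{i<N} b.r_i) + sum_{i<N} b.(a || r_i),
  where r_i = a^{i+1} b, since these processes have literally the same transitions. Up to inert
  parallel components, the first one has a summand p || q with p having the traces of a and q
  those of sum_i b.r_i; the second one has none. Every sound equation between terms of size below
  N preserves the presence of such a summand. If it comes from a variable, then substituting a
  process c.r with r indecomposable shows that the variable is a summand of both sides. Otherwise
  it comes from a summand t1 || t2 of the term; as t2 is too small to supply all branches b.r_i by
  prefixes, it has a variable as a summand, and substituting b.r for that variable forces a
  summand u1 || u2 with u1 having the traces of a on the other side.
*)

theory Submission
  imports Defs "HOL-Library.Sublist"
begin

section \<open>Traces and one-step futures\<close>

definition traces :: "('a, 'v) trm \<Rightarrow> 'a list set" where
  "traces p = {w. \<exists>p'. path p w p'}"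

text \<open>A compositional abstraction coarse enough to be preserved by both equivalences from
  level two on. Apart from the lemmas on the two equivalences, the argument sees processes only
  through it and their summands.\<close>

definition futures :: "('a, 'v) trm \<Rightarrow> ('a \<times> 'a list set) set" where
  "futures p = {(c, traces p') |c p'. step p c p'}"

section \<open>Shuffles of trace sets\<close>

definition shuffle_sets :: "'a list set \<Rightarrow> 'a list set \<Rightarrow> 'a list set" where
  "shuffle_sets X Y = (\<Union>x\<in>X. \<Union>y\<in>Y. shuffles x y)"

lemma shuffle_sets_commute: "shuffle_sets X Y = shuffle_sets Y X"
  unfolding shuffle_sets_def using shuffles_commutes by blast

lemma shuffle_sets_Nil [simp]: "shuffle_sets X {[]} = X" "shuffle_sets {[]} X = X"
  by (auto simp: shuffle_sets_def)

lemma append_in_shuffles: "xs @ ys \<in> shuffles xs ys"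
  by (induction xs) (auto intro: Cons_in_shuffles_leftI)

lemma append_in_shuffle_sets: "x \<in> X \<Longrightarrow> y \<in> Y \<Longrightarrow> x @ y \<in> shuffle_sets X Y"
  using append_in_shuffles by (fastforce simp: shuffle_sets_def)

lemma append_in_shuffle_sets': "x \<in> X \<Longrightarrow> y \<in> Y \<Longrightarrow> y @ x \<in> shuffle_sets X Y"
  using append_in_shuffle_sets by (metis shuffle_sets_commute)

lemma shuffle_setsE:
  assumes "w \<in> shuffle_sets X Y"
  obtains x y where "x \<in> X" "y \<in> Y" "w \<in> shuffles x y"
    "length w = length x + length y" "set w = set x \<union> set y"
  using assms length_shuffles set_shuffles by (fastforce simp: shuffle_sets_def)

lemma Cons_in_shuffle_sets_iff: "c # w \<in> shuffle_sets X Y \<longleftrightarrow>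
    (\<exists>x. c # x \<in> X \<and> (\<exists>y\<in>Y. w \<in> shuffles x y)) \<or>
    (\<exists>x\<in>X. \<exists>y. c # y \<in> Y \<and> w \<in> shuffles x y)" (is "?l \<longleftrightarrow> ?r")
proof
  assume ?l
  then obtain x y where "x \<in> X" "y \<in> Y" "c # w \<in> shuffles x y"
    by (auto simp: shuffle_sets_def)
  then consider x' where "x = c # x'" "w \<in> shuffles x' y" | y' where "y = c # y'" "w \<in> shuffles x y'"
    by (cases x; cases y) (force simp: Cons_in_shuffles_iff)+
  then show ?r
  proof cases
    case 1
    then show ?thesis using \<open>x \<in> X\<close> \<open>y \<in> Y\<close> by auto
  next
    case 2
    then have "\<exists>x\<in>X. \<exists>y. c # y \<in> Y \<and> w \<in> shuffles x y"
      using \<open>x \<in> X\<close> \<open>y \<in> Y\<close> by (intro bexI[of _ x] exI[of _ y']) auto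
    then show ?thesis by (rule disjI2)
  qed
next
  assume ?r
  then show ?l
    unfolding shuffle_sets_def
    using Cons_in_shuffles_leftI[of w _ _ c] Cons_in_shuffles_rightI[of w _ _ c] by fast
qed

lemma shuffle_sets_eq_Nil_iff:
  assumes "[] \<in> X" "[] \<in> Y"
  shows "shuffle_sets X Y = {[]} \<longleftrightarrow> X = {[]} \<and> Y = {[]}"
proof
  assume eq: "shuffle_sets X Y = {[]}"
  have "x = []" if "x \<in> X" for x
    using append_in_shuffle_sets[OF that assms(2)] eq by simp
  moreover have "y = []" if "y \<in> Y" for y
    using append_in_shuffle_sets[OF assms(1) that] eq by simp
  ultimately show "X = {[]} \<and> Y = {[]}" using assms by blast
qed simp

section \<open>Traces and futures of the operators\<close>

inductive_cases step_ZeroE [elim!]: "step Zero c p"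
inductive_cases step_VarE [elim!]: "step (Var x) c p"
inductive_cases step_PreE [elim!]: "step (Pre d p) c p'"
inductive_cases step_ChoiceE [elim!]: "step (Choice p q) c r"
inductive_cases step_ParE: "step (Par p q) c r"
inductive_cases path_NilE: "path p [] p'"
inductive_cases path_ConsE: "path p (c # w) p'"

lemma path_Cons_iff: "path p (c # w) r \<longleftrightarrow> (\<exists>p'. step p c p' \<and> path p' w r)"
  by (auto elim: path_ConsE intro: path.cons)

lemma path_Nil_iff [simp]: "path p [] r \<longleftrightarrow> r = p"
  by (auto elim: path_NilE intro: path.empty)

lemma path_single: "step p c p' \<Longrightarrow> path p [c] p'"
  by (simp add: path_Cons_iff)

lemma Nil_in_traces [simp]: "[] \<in> traces p"
  by (auto simp: traces_def intro: path.empty)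

lemma Cons_in_traces_iff: "c # w \<in> traces p \<longleftrightarrow> (\<exists>p'. step p c p' \<and> w \<in> traces p')"
  unfolding traces_def mem_Collect_eq path_Cons_iff by blast

lemma Cons_in_traces_iff_futures: "c # w \<in> traces p \<longleftrightarrow> (\<exists>X. (c, X) \<in> futures p \<and> w \<in> X)"
  by (auto simp: futures_def Cons_in_traces_iff)

text \<open>The futures of a parallel composition also depend on the traces of its factors;
  recovering traces from futures makes equality of futures a congruence.\<close>

lemma traces_eqI: "futures p = futures q \<Longrightarrow> traces p = traces q"
proof (rule set_eqI)
  fix w assume "futures p = futures q"
  then show "w \<in> traces p \<longleftrightarrow> w \<in> traces q"
    by (cases w) (auto simp: Cons_in_traces_iff_futures)
qed

lemma Nil_in_future: "(c, X) \<in> futures p \<Longrightarrow> [] \<in> X"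
  by (auto simp: futures_def)

lemma traces_eq_Nil_iff: "traces p = {[]} \<longleftrightarrow> futures p = {}"
proof
  assume "traces p = {[]}"
  then show "futures p = {}"
    using Cons_in_traces_iff_futures[of _ "[]" p] Nil_in_future by fastforce
next
  assume "futures p = {}"
  then have "w \<in> traces p \<Longrightarrow> w = []" for w
    by (cases w) (auto simp: Cons_in_traces_iff_futures)
  then show "traces p = {[]}" by auto
qed

lemma nonnull_trace:
  assumes "traces p \<noteq> {[]}"
  obtains c where "[c] \<in> traces p"
proof -
  from assms obtain c X where "(c, X) \<in> futures p"
    by (auto simp: traces_eq_Nil_iff)
  then have "[c] \<in> traces p"
    using Nil_in_future by (fastforce simp: Cons_in_traces_iff_futures)
  then show thesis by (rule that)
qed

lemma traces_Zero [simp]: "traces Zero = {[]}"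
  and traces_Var [simp]: "traces (Var x) = {[]}"
  by (auto simp: traces_eq_Nil_iff futures_def)

lemma traces_Pre: "traces (Pre c p) = insert [] ((#) c ` traces p)"
proof (rule set_eqI)
  fix w show "w \<in> traces (Pre c p) \<longleftrightarrow> w \<in> insert [] ((#) c ` traces p)"
    by (cases w) (auto simp: Cons_in_traces_iff intro: step.intros)
qed

lemma traces_Choice: "traces (Choice p q) = traces p \<union> traces q"
proof (rule set_eqI)
  fix w show "w \<in> traces (Choice p q) \<longleftrightarrow> w \<in> traces p \<union> traces q"
    by (cases w) (auto simp: Cons_in_traces_iff intro: step.intros)
qed

lemma step_Par_iff: "step (Par p q) c r \<longleftrightarrow>
    (\<exists>p'. step p c p' \<and> r = Par p' q) \<or> (\<exists>q'. step q c q' \<and> r = Par p q')"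
  by (auto elim: step_ParE intro: step.intros)

lemma traces_Par: "traces (Par p q) = shuffle_sets (traces p) (traces q)"
proof -
  have "w \<in> traces (Par p q) \<longleftrightarrow> w \<in> shuffle_sets (traces p) (traces q)" for w
  proof (induction w arbitrary: p q)
    case Nil
    then show ?case using append_in_shuffle_sets[of "[]" "traces p" "[]" "traces q"] by simp
  next
    case (Cons c w)
    have "c # w \<in> traces (Par p q) \<longleftrightarrow>
        (\<exists>p'. step p c p' \<and> w \<in> shuffle_sets (traces p') (traces q)) \<or>
        (\<exists>q'. step q c q' \<and> w \<in> shuffle_sets (traces p) (traces q'))"
      by (auto simp: Cons_in_traces_iff step_Par_iff Cons)
    also have "\<dots> \<longleftrightarrow> (\<exists>x. c # x \<in> traces p \<and> (\<exists>y\<in>traces q. w \<in> shuffles x y)) \<or>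
        (\<exists>x\<in>traces p. \<exists>y. c # y \<in> traces q \<and> w \<in> shuffles x y)"
      unfolding shuffle_sets_def Cons_in_traces_iff by blast
    also have "\<dots> \<longleftrightarrow> c # w \<in> shuffle_sets (traces p) (traces q)"
      by (rule Cons_in_shuffle_sets_iff [symmetric])
    finally show ?case .
  qed
  then show ?thesis by blast
qed

lemma futures_Zero [simp]: "futures Zero = {}"
  and futures_Var [simp]: "futures (Var x) = {}"
  by (auto simp: futures_def)

lemma futures_Pre: "futures (Pre c p) = {(c, traces p)}"
  by (auto simp: futures_def intro: step.intros)

lemma futures_Choice: "futures (Choice p q) = futures p \<union> futures q"
  by (auto simp: futures_def intro: step.intros)

lemma futures_Par: "futures (Par p q) =
    (\<lambda>(c, X). (c, shuffle_sets X (traces q))) ` futures p \<union>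
    (\<lambda>(c, X). (c, shuffle_sets (traces p) X)) ` futures q"
  by (force simp: futures_def step_Par_iff traces_Par)

lemma futures_Par_commute: "futures (Par p q) = futures (Par q p)"
  unfolding futures_Par by (auto simp: shuffle_sets_commute)

lemma in_futures_Par_left:
  "(c, X) \<in> futures p \<Longrightarrow> (c, shuffle_sets X (traces q)) \<in> futures (Par p q)"
  by (force simp: futures_Par)

lemma in_futures_Par_right:
  "(c, X) \<in> futures q \<Longrightarrow> (c, shuffle_sets (traces p) X) \<in> futures (Par p q)"
  by (force simp: futures_Par)

lemma length_trace_le_size: "w \<in> traces p \<Longrightarrow> length w \<le> size p"
proof (induction p arbitrary: w)
  case (Par p q)
  then show ?case by (fastforce simp: traces_Par elim!: shuffle_setsE)
next
  case (Choice p q)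
  then show ?case by (fastforce simp: traces_Choice)
qed (auto simp: traces_Pre)

section \<open>The behavioural equivalences preserve one-step futures\<close>

lemma nested_trace_equiv_sym: "(p, q) \<in> nested_trace_equiv n \<Longrightarrow> (q, p) \<in> nested_trace_equiv n"
proof (induction n arbitrary: p q)
  case (Suc n)
  then show ?case unfolding nested_trace_equiv.simps(2) mem_Collect_eq case_prod_conv by metis
qed simp

lemma nested_trace_equivD:
  "(p, q) \<in> nested_trace_equiv (Suc n) \<Longrightarrow> path p w p' \<Longrightarrow>
    \<exists>q'. path q w q' \<and> (p', q') \<in> nested_trace_equiv n"
  by simp

lemma nested_trace_equiv_traces:
  assumes "(p, q) \<in> nested_trace_equiv (Suc n)"
  shows "traces p = traces q"
  using nested_trace_equivD[OF assms] nested_trace_equivD[OF nested_trace_equiv_sym[OF assms]]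
  unfolding traces_def by blast

text \<open>A path of length one is matched at level two by a path whose end is related at level
  one, where relatedness forces equal trace sets.\<close>

lemma nested_trace_equiv_futures:
  assumes "(p, q) \<in> nested_trace_equiv (Suc (Suc n))"
  shows "futures p = futures q"
proof -
  have "futures p \<subseteq> futures q"
    if pq: "(p, q) \<in> nested_trace_equiv (Suc (Suc n))" for p q :: "('a, 'b) trm"
  proof -
    have "\<exists>q'. step q c q' \<and> traces p' = traces q'" if "step p c p'" for c p'
      using nested_trace_equivD[OF pq path_single[OF that]] nested_trace_equiv_traces
      by (metis path_Cons_iff path_Nil_iff)
    then show ?thesis unfolding futures_def by blast
  qed
  then show ?thesis using assms nested_trace_equiv_sym by blast
qed

lemma simulation_traces:
  assumes "simulation S"
  shows "(p, q) \<in> S \<Longrightarrow> traces p \<subseteq> traces q"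
proof
  fix w assume "w \<in> traces p" "(p, q) \<in> S"
  then show "w \<in> traces q"
  proof (induction w arbitrary: p q)
    case (Cons c w)
    then show ?case using assms by (fastforce simp: Cons_in_traces_iff simulation_def)
  qed simp
qed

lemma nested_sim_preorder_futures:
  assumes "(p, q) \<in> nested_sim_preorder (Suc (Suc n))"
  shows "futures p \<subseteq> futures q"
proof -
  obtain S where S: "simulation S" "S\<inverse> \<subseteq> nested_sim_preorder (Suc n)" "(p, q) \<in> S"
    using assms unfolding nested_sim_preorder.simps(2)[of "Suc n"] by blast
  have "\<exists>q'. step q c q' \<and> traces p' = traces q'" if st: "step p c p'" for c p'
  proof -
    obtain q' where q': "step q c q'" "(p', q') \<in> S"
      using S st unfolding simulation_def by blast
    \<comment> \<open>The nesting supplies the converse trace inclusion: the inverse of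
      \<open>S\<close> lies in a preorder that is itself given by simulations.\<close>
    have "(q', p') \<in> nested_sim_preorder (Suc n)" using q' S by blast
    then have "traces q' \<subseteq> traces p'" using simulation_traces by auto
    then show ?thesis using q' simulation_traces S by blast
  qed
  then show ?thesis unfolding futures_def by blast
qed

lemma nested_sim_equiv_futures:
  "(p, q) \<in> nested_sim_equiv (Suc (Suc n)) \<Longrightarrow> futures p = futures q"
  using nested_sim_preorder_futures unfolding nested_sim_equiv_def by blast

section \<open>Processes with identical transitions are equivalent at every level\<close>

lemma step_processes: "step p c p' \<Longrightarrow> p \<in> processes \<Longrightarrow> p' \<in> processes"
  by (induction rule: step.induct) (auto simp: processes_def)

lemma path_processes: "path p w p' \<Longrightarrow> p \<in> processes \<Longrightarrow> p' \<in> processes"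
  by (induction rule: path.induct) (auto intro: step_processes)

lemma nested_trace_equiv_refl: "p \<in> processes \<Longrightarrow> (p, p) \<in> nested_trace_equiv n"
  by (induction n arbitrary: p) (auto dest: path_processes)

text \<open>Nonempty paths from \<open>p\<close> and \<open>q\<close> end in literally the same
  processes, where reflexivity suffices; only the empty path compares \<open>p\<close> with
  \<open>q\<close> and needs the induction on \<open>n\<close>.\<close>

lemma nested_trace_equivI:
  assumes "p \<in> processes" "q \<in> processes" "\<And>c r. step p c r \<longleftrightarrow> step q c r"
  shows "(p, q) \<in> nested_trace_equiv n"
proof (induction n)
  case (Suc n)
  have same: "path p (c # w) r \<longleftrightarrow> path q (c # w) r" for c w r
    using assms by (auto simp: path_Cons_iff)
  have "\<exists>q'. path q w q' \<and> (p', q') \<in> nested_trace_equiv n" if "path p w p'" for w p'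
  proof (cases w)
    case Nil
    then show ?thesis using that Suc by (auto intro: path.empty)
  next
    case (Cons c v)
    then show ?thesis
      using that same[of c v p'] nested_trace_equiv_refl path_processes[OF that assms(1)] by metis
  qed
  moreover have "\<exists>p'. path p w p' \<and> (p', q') \<in> nested_trace_equiv n" if "path q w q'" for w q'
  proof (cases w)
    case Nil
    then show ?thesis using that Suc by (auto intro: path.empty)
  next
    case (Cons c v)
    then show ?thesis
      using that same[of c v q'] nested_trace_equiv_refl path_processes[OF that assms(2)] by metis
  qed
  ultimately show ?case using assms by simp
qed (use assms in simp)

lemma nested_sim_equivI:
  assumes "p \<in> processes" "q \<in> processes" "\<And>c r. step p c r \<longleftrightarrow> step q c r"
  shows "(p, q) \<in> nested_sim_equiv n"
proof -
  \<comment> \<open>Being symmetric, this one simulation meets the condition on the inverse at all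
    levels.\<close>
  define S where "S = Id_on processes \<union> {(p, q), (q, p)}"
  have "\<exists>s'. step s c s' \<and> (r', s') \<in> S" if "(r, s) \<in> S" "step r c r'" for r s c r'
  proof -
    have "step s c r'" "r' \<in> processes"
      using that assms step_processes[of r c r'] by (auto simp: S_def)
    then show ?thesis by (auto simp: S_def)
  qed
  moreover have "S \<subseteq> processes \<times> processes" using assms by (auto simp: S_def)
  ultimately have S: "simulation S" by (auto simp: simulation_def)
  have conv: "S\<inverse> = S" by (auto simp: S_def)
  have "S \<subseteq> nested_sim_preorder n"
  proof (induction n)
    case 0
    then show ?case using S by (simp add: simulation_def)
  next
    case (Suc n)
    then show ?case using S conv by (auto intro!: exI[of _ S])
  qed
  then show ?thesis by (auto simp: S_def nested_sim_equiv_def)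
qed


section \<open>Summands up to null factors\<close>

text \<open>The set \<^term>\<open>Z\<close> holds the variables that a substitution maps to inert processes.\<close>

primrec null :: "'v set \<Rightarrow> ('a, 'v) trm \<Rightarrow> bool" where
  "null Z Zero = True"
| "null Z (Var x) = (x \<in> Z)"
| "null Z (Pre c t) = False"
| "null Z (Choice t u) = (null Z t \<and> null Z u)"
| "null Z (Par t u) = (null Z t \<and> null Z u)"

text \<open>Null factors are looked through, so a \<open>Par\<close> in the result always has two
  nonnull factors. This keeps laws that add or drop an inert component from creating or destroying
  summands.\<close>

primrec summands :: "'v set \<Rightarrow> ('a, 'v) trm \<Rightarrow> ('a, 'v) trm set" where
  "summands Z Zero = {}"
| "summands Z (Var x) = (if x \<in> Z then {} else {Var x})"
| "summands Z (Pre c t) = {Pre c t}"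
| "summands Z (Choice t u) = summands Z t \<union> summands Z u"
| "summands Z (Par t u) =
    (if null Z u then summands Z t else if null Z t then summands Z u else {Par t u})"

definition null_vars :: "('v \<Rightarrow> ('a, 'v) trm) \<Rightarrow> 'v set" where
  "null_vars \<sigma> = {x. traces (\<sigma> x) = {[]}}"

lemma null_iff: "null (null_vars \<sigma>) t \<longleftrightarrow> traces (subst \<sigma> t) = {[]}"
proof (induction t)
  case (Choice t u)
  then show ?case by (auto simp: traces_Choice intro: Nil_in_traces)
next
  case (Par t u)
  then show ?case by (simp add: traces_Par shuffle_sets_eq_Nil_iff)
qed (auto simp: null_vars_def traces_Pre)

lemma null_UNIV_iff: "null UNIV p \<longleftrightarrow> traces p = {[]}"
proof (induction p)
  case (Choice t u)
  then show ?case by (auto simp: traces_Choice intro: Nil_in_traces)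
next
  case (Par t u)
  then show ?case by (simp add: traces_Par shuffle_sets_eq_Nil_iff)
qed (auto simp: traces_Pre)

lemma finite_summands [simp]: "finite (summands Z t)"
  by (induction t) auto

text \<open>The extra one is due to variables, which have size zero but may be a summand.\<close>

lemma card_summands_le_size: "card (summands Z t) \<le> Suc (size t)"
proof (induction t)
  case (Choice t u)
  then show ?case using card_Un_le[of "summands Z t" "summands Z u"] by simp
qed auto

lemma summand_size: "s \<in> summands Z t \<Longrightarrow> size (subst \<sigma> s) \<le> size (subst \<sigma> t)"
  by (induction t) (auto split: if_splits)

lemma summand_Var: "Var x \<in> summands Z t \<Longrightarrow> x \<notin> Z"
  by (induction t) (auto split: if_splits)

lemma summand_cases:
  assumes "s \<in> summands Z t"
  obtains (Var) x where "s = Var x" "x \<notin> Z"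
    | (Pre) c u where "s = Pre c u"
    | (Par) u v where "s = Par u v" "\<not> null Z u" "\<not> null Z v"
  using assms by (induction t) (auto split: if_splits)

lemma futures_Par_null:
  assumes "traces q = {[]}"
  shows "futures (Par p q) = futures p" "futures (Par q p) = futures p"
proof -
  show "futures (Par p q) = futures p"
    using assms by (auto simp: futures_Par traces_eq_Nil_iff[THEN iffD1, OF assms])
  then show "futures (Par q p) = futures p" by (simp add: futures_Par_commute)
qed

text \<open>Null factors do not affect futures. Hence each future of an instance can be traced back
  to a single summand of the open term.\<close>

lemma futures_subst:
  "futures (subst \<sigma> t) = (\<Union>s\<in>summands (null_vars \<sigma>) t. futures (subst \<sigma> s))"
proof (induction t)
  case (Var x)
  then show ?case by (simp add: null_vars_def traces_eq_Nil_iff)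
next
  case (Par t u)
  then show ?case by (auto simp: futures_Par_null null_iff)
qed (auto simp: futures_Choice)

text \<open>Only a variable summand can dissolve into further summands: the factors of a
  \<open>Par\<close> summand are nonnull under \<open>\<sigma>\<close> and so remain nonnull. On the
  instance the null set is \<open>UNIV\<close>, as leftover variables have no transitions.\<close>

lemma summands_subst:
  "summands UNIV (subst \<sigma> t) =
    (\<Union>s\<in>summands (null_vars \<sigma>) t. case s of Var x \<Rightarrow> summands UNIV (\<sigma> x) | _ \<Rightarrow> {subst \<sigma> s})"
proof (induction t)
  case (Var x)
  have "null UNIV p \<Longrightarrow> summands UNIV p = {}" for p :: "('a, 'b) trm"
    by (induction p) auto
  then show ?case by (auto simp: null_vars_def null_UNIV_iff)
next
  case (Par t u)
  then show ?case by (auto simp: null_iff null_UNIV_iff)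
qed auto

section \<open>Substitutions\<close>

lemma subst_cong: "(\<And>x. x \<in> vars t \<Longrightarrow> \<sigma> x = \<tau> x) \<Longrightarrow> subst \<sigma> t = subst \<tau> t"
  by (induction t) auto

lemma vars_subst_closed: "closed_subst \<sigma> \<Longrightarrow> vars (subst \<sigma> t) = {}"
  by (induction t) (auto simp: closed_subst_def processes_def)

lemma subst_subst: "subst \<sigma> (subst \<tau> t) = subst (\<lambda>x. subst \<sigma> (\<tau> x)) t"
  by (induction t) auto

text \<open>Run the prefixes above an occurrence of \<open>x\<close> and let all parallel factors
  beside it idle; then perform \<open>z\<close>.\<close>

lemma trace_of_var:
  assumes "x \<in> vars t" "z \<in> traces (\<sigma> x)"
  obtains w where "w @ z \<in> traces (subst \<sigma> t)"
proof -
  have "\<exists>w. w @ z \<in> traces (subst \<sigma> t)"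
    using assms(1)
  proof (induction t)
    case (Var y)
    then show ?case using assms by (auto intro: exI[of _ "[]"])
  next
    case (Pre c t)
    then obtain w where "w @ z \<in> traces (subst \<sigma> t)" by auto
    then have "(c # w) @ z \<in> traces (subst \<sigma> (Pre c t))" by (simp add: traces_Pre)
    then show ?case by blast
  next
    case (Par t u)
    then consider w where "w @ z \<in> traces (subst \<sigma> t)" | w where "w @ z \<in> traces (subst \<sigma> u)"
      by auto
    then have "\<exists>w. w @ z \<in> shuffle_sets (traces (subst \<sigma> t)) (traces (subst \<sigma> u))"
    proof cases
      case 1
      then show ?thesis using append_in_shuffle_sets[OF 1 Nil_in_traces] by auto
    next
      case 2
      then show ?thesis using append_in_shuffle_sets[OF Nil_in_traces 2] by auto
    qed
    then show ?case by (simp add: traces_Par)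
  qed (auto simp: traces_Choice)
  then show thesis using that by blast
qed

section \<open>Probing an equation with one long and one short branch\<close>

definition probe :: "'a \<Rightarrow> 'a \<Rightarrow> nat \<Rightarrow> ('a, 'v) trm" where
  "probe a b m = Choice ((Pre a ^^ m) Zero) (Pre b Zero)"

lemma traces_Pre_funpow: "traces ((Pre a ^^ m) Zero) = {replicate i a |i. i \<le> m}"
proof (induction m)
  case (Suc m)
  have "{replicate i a |i. i \<le> Suc m} = insert [] ((#) a ` {replicate i a |i. i \<le> m})"
    (is "?l = ?r")
  proof
    show "?l \<subseteq> ?r"
    proof
      fix w assume "w \<in> ?l"
      then obtain i where "i \<le> Suc m" "w = replicate i a" by blast
      then show "w \<in> ?r" by (cases i) auto
    qed
    show "?r \<subseteq> ?l"
    proof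
      fix w assume "w \<in> ?r"
      then consider "w = []" | i where "w = replicate (Suc i) a" "Suc i \<le> Suc m" by auto
      then show "w \<in> ?l" by cases (auto simp del: replicate_Suc intro: exI[of _ 0])
    qed
  qed
  then show ?case using Suc by (simp add: traces_Pre)
qed auto

lemma traces_probe: "traces (probe a b m) = insert [b] {replicate i a |i. i \<le> m}"
proof -
  have "[] \<in> {replicate i a |i. i \<le> m}" by (rule CollectI, rule exI[of _ 0]) simp
  then show ?thesis by (auto simp: probe_def traces_Choice traces_Pre_funpow traces_Pre)
qed

lemma vars_probe [simp]: "vars (probe a b m) = {}"
  by (induction m) (auto simp: probe_def)

lemma closed_subst_upd: "closed_subst \<sigma> \<Longrightarrow> vars p = {} \<Longrightarrow> closed_subst (\<sigma>(x := p))"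
  by (simp add: closed_subst_def processes_def)

text \<open>Replacing one nonnull value by another leaves the summands of open terms as they
  were.\<close>

lemma null_vars_upd:
  "x \<notin> null_vars \<sigma> \<Longrightarrow> traces p \<noteq> {[]} \<Longrightarrow> null_vars (\<sigma>(x := p)) = null_vars \<sigma>"
  by (auto simp: null_vars_def)

lemma traces_Pre_nonnull: "traces (Pre c p) \<noteq> {[]}"
  by (auto simp: traces_eq_Nil_iff futures_Pre)

text \<open>The set of traces of a probe is indecomposable: a trace containing \<^term>\<open>b\<close> has
  length one, so no two nonnull processes running in parallel can produce it.\<close>

lemma Var_summand_transfer:
  fixes t u :: "('a, 'v) trm" and \<sigma> :: "'v \<Rightarrow> ('a, 'v) trm" and a b :: 'a
  assumes sound: "\<And>\<sigma>. closed_subst \<sigma> \<Longrightarrow> futures (subst \<sigma> t) = futures (subst \<sigma> u)"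
    and \<sigma>: "closed_subst \<sigma>" and x: "Var x \<in> summands (null_vars \<sigma>) t" and "a \<noteq> b"
  shows "Var x \<in> summands (null_vars \<sigma>) u"
proof -
  \<comment> \<open>Traces of \<open>subst \<sigma> u\<close> are shorter than \<open>m\<close>, so
    no term of that size produces the long branch of the probe.\<close>
  define m where "m = Suc (size (subst \<sigma> u))"
  define R where "R = traces (probe a b m :: ('a, 'v) trm)"
  \<comment> \<open>The leading \<open>a\<close> makes \<open>(a, R)\<close> the only future of the
    new value of \<open>x\<close>.\<close>
  define \<tau> where "\<tau> = \<sigma>(x := Pre a (probe a b m))"
  have \<tau>: "closed_subst \<tau>" using \<sigma> by (simp add: \<tau>_def closed_subst_upd)
  have Z: "null_vars \<tau> = null_vars \<sigma>"
    unfolding \<tau>_def using summand_Var[OF x] traces_Pre_nonnull by (rule null_vars_upd)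
  have long: "replicate m a \<in> R" and short: "[b] \<in> R"
    by (auto simp: R_def traces_probe)
  have bound: "length w \<le> m" if "w \<in> R" for w
    using that by (auto simp: R_def traces_probe m_def)
  have b_short: "length w \<le> 1" if "w \<in> R" "b \<in> set w" for w
    using that \<open>a \<noteq> b\<close> by (auto simp: R_def traces_probe)
  have long_x: "a # replicate m a \<in> traces (\<tau> x)"
    using long by (simp add: \<tau>_def traces_Pre R_def)
  \<comment> \<open>A term containing \<open>x\<close> has a trace ending in
    \<open>a # replicate m a\<close>, which is longer than every trace in \<open>R\<close>.\<close>
  have not_var: "x \<notin> vars v" if "traces (subst \<tau> v) \<subseteq> R" for v
  proof
    assume "x \<in> vars v"
    then obtain w where "w @ a # replicate m a \<in> traces (subst \<tau> v)"
      using long_x by (rule trace_of_var)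
    then have "w @ a # replicate m a \<in> R" using that by (rule rev_subsetD)
    then show False using bound[of "w @ a # replicate m a"] by simp
  qed
  have small: "replicate m a \<notin> traces (subst \<tau> v)"
    if "x \<notin> vars v" "size (subst \<sigma> v) \<le> size (subst \<sigma> u)" for v
  proof
    assume "replicate m a \<in> traces (subst \<tau> v)"
    moreover have "subst \<tau> v = subst \<sigma> v"
      using that(1) by (intro subst_cong) (auto simp: \<tau>_def)
    ultimately show False using length_trace_le_size that(2) by (fastforce simp: m_def)
  qed
  have "(a, R) \<in> futures (subst \<tau> (Var x))" by (simp add: \<tau>_def R_def futures_Pre)
  then have "(a, R) \<in> futures (subst \<tau> t)"
    using x unfolding futures_subst[of \<tau> t] Z by blast
  then have "(a, R) \<in> futures (subst \<tau> u)" using sound[OF \<tau>] by simp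
  then obtain s where s: "s \<in> summands (null_vars \<sigma>) u" "(a, R) \<in> futures (subst \<tau> s)"
    unfolding futures_subst[of \<tau> u] Z by blast
  have size_s: "size (subst \<sigma> s) \<le> size (subst \<sigma> u)" using s(1) by (rule summand_size)
  \<comment> \<open>Here \<open>v\<close> moves, leaving traces \<open>X\<close>, and
    \<open>w\<close> stays. If \<open>X\<close> supplied the \<open>b\<close> of the trace
    \<open>[b]\<close>, a letter of \<open>w\<close> could follow it within \<open>R\<close>; so
    \<open>w\<close> supplies it, and any nonempty trace of \<open>X\<close> could precede it. Hence
    \<open>X\<close> is trivial and \<open>w\<close> alone has the traces \<open>R\<close>, against
    \<open>not_var\<close> and \<open>small\<close>.\<close>
  have Par_False: False
    if fut: "(a, X) \<in> futures (subst \<tau> v)" and R: "R = shuffle_sets X (traces (subst \<tau> w))"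
      and w: "\<not> null (null_vars \<sigma>) w" "size (subst \<sigma> w) \<le> size (subst \<sigma> u)" for X v w
  proof -
    have Nil: "[] \<in> X" using fut by (rule Nil_in_future)
    have "traces (subst \<tau> w) \<noteq> {[]}" using w(1) null_iff[of \<tau> w] Z by simp
    then obtain d where d: "[d] \<in> traces (subst \<tau> w)" by (rule nonnull_trace)
    have X: "z = []" if z: "z \<in> X" for z
    proof (rule ccontr)
      assume "z \<noteq> []"
      have "[b] \<in> shuffle_sets X (traces (subst \<tau> w))" using short R by simp
      then obtain y y' where y: "y \<in> X" "y' \<in> traces (subst \<tau> w)" "set [b] = set y \<union> set y'"
        by (rule shuffle_setsE)
      then consider "b \<in> set y" | "b \<in> set y'" by auto
      then show False
      proof cases
        case 1
        have "y @ [d] \<in> R" using append_in_shuffle_sets[OF y(1) d] R by simp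
        then show False using b_short[of "y @ [d]"] 1 by auto
      next
        case 2
        have "z @ y' \<in> R" using append_in_shuffle_sets[OF z y(2)] R by simp
        then show False using b_short[of "z @ y'"] 2 \<open>z \<noteq> []\<close> by (cases z; cases y') auto
      qed
    qed
    then have "X = {[]}" using Nil by auto
    then have "traces (subst \<tau> w) = R" using R by simp
    then show False using small[OF not_var w(2)] long by simp
  qed
  from s(1) show ?thesis
  proof (cases rule: summand_cases)
    case (Var y)
    show ?thesis
    proof (cases "y = x")
      case False
      have "a # replicate m a \<in> traces (\<sigma> y)"
        using s(2) Var False long by (auto simp: Cons_in_traces_iff_futures \<tau>_def)
      then show ?thesis using length_trace_le_size size_s Var by (fastforce simp: m_def)
    qed (use s Var in simp)
  next
    case (Pre c v)
    then have "traces (subst \<tau> v) = R" using s(2) by (auto simp: futures_Pre)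
    then show ?thesis using small[OF not_var, of v] long size_s Pre by auto
  next
    case (Par v w)
    then show ?thesis
      using s(2) size_s Par_False[of _ v w] Par_False[of _ w v]
      by (auto simp: futures_Par shuffle_sets_commute)
  qed
qed

text \<open>Symmetric in the factors, so that the factor with the traces of \<open>a\<close> can
  always be named first.\<close>

definition parallel_summand ::
    "'v set \<Rightarrow> ('a, 'v) trm \<Rightarrow> ('a, 'v) trm \<Rightarrow> ('a, 'v) trm \<Rightarrow> bool" where
  "parallel_summand Z t u v \<longleftrightarrow> Par u v \<in> summands Z t \<or> Par v u \<in> summands Z t"

lemma summand_futures:
  "s \<in> summands (null_vars \<sigma>) t \<Longrightarrow> futures (subst \<sigma> s) \<subseteq> futures (subst \<sigma> t)"
  unfolding futures_subst[of \<sigma> t] by blast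

lemma futures_subset_traces:
  assumes "futures p \<subseteq> futures q"
  shows "traces p \<subseteq> traces q"
proof
  fix w assume "w \<in> traces p"
  then show "w \<in> traces q"
    using assms by (cases w) (auto simp: Cons_in_traces_iff_futures)
qed

lemma parallel_summand_futures:
  assumes "parallel_summand (null_vars \<sigma>) t u v"
  shows "futures (Par (subst \<sigma> u) (subst \<sigma> v)) \<subseteq> futures (subst \<sigma> t)"
  using assms summand_futures[of "Par u v" \<sigma> t] summand_futures[of "Par v u" \<sigma> t]
  by (auto simp: parallel_summand_def futures_Par_commute[of "subst \<sigma> v"])

text \<open>Giving \<open>y\<close> the value \<open>b.probe\<close> adds to the left side a future
  in which a unit runs beside the probe. Prefixes and other variables of the right side are too
  small to yield it, and \<open>y\<close> alone yields only the probe; what remains is a parallel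
  summand whose idle factor is the unit.\<close>

lemma Par_summand_transfer:
  fixes t u :: "('a, 'v) trm" and \<sigma> :: "'v \<Rightarrow> ('a, 'v) trm" and a b :: 'a
  assumes sound: "\<And>\<sigma>. closed_subst \<sigma> \<Longrightarrow> futures (subst \<sigma> t) = futures (subst \<sigma> u)"
    and \<sigma>: "closed_subst \<sigma>" and par: "parallel_summand (null_vars \<sigma>) t t1 t2"
    and t1: "traces (subst \<sigma> t1) = {[], [a]}"
    and y: "Var y \<in> summands (null_vars \<sigma>) t2" "y \<notin> vars t1" and "a \<noteq> b"
  obtains u1 u2 where "parallel_summand (null_vars \<sigma>) u u1 u2" "traces (subst \<sigma> u1) = {[], [a]}"
proof -
  \<comment> \<open>The slack ensures that a factor of size at most that of
    \<open>subst \<sigma> u\<close> leaves at least two letters of the long trace to the other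
    factor.\<close>
  define m where "m = size (subst \<sigma> u) + 3"
  define R where "R = traces (probe a b m :: ('a, 'v) trm)"
  define Q where "Q = shuffle_sets {[], [a]} R"
  define \<tau> where "\<tau> = \<sigma>(y := Pre b (probe a b m))"
  have \<tau>: "closed_subst \<tau>" using \<sigma> by (simp add: \<tau>_def closed_subst_upd)
  have Z: "null_vars \<tau> = null_vars \<sigma>"
    unfolding \<tau>_def using summand_Var[OF y(1)] traces_Pre_nonnull by (rule null_vars_upd)
  have longR: "replicate m a \<in> R" and shortR: "[b] \<in> R"
    by (auto simp: R_def traces_probe)
  have "length w \<le> m" if "w \<in> R" for w
    using that by (auto simp: R_def traces_probe m_def)
  from this[of "a # replicate m a"] have boundR: "a # replicate m a \<notin> R" by auto
  have "[a] @ replicate m a \<in> Q"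
    unfolding Q_def using longR by (intro append_in_shuffle_sets) auto
  then have long: "a # replicate m a \<in> Q" by simp
  have "[] @ [b] \<in> Q"
    unfolding Q_def using shortR by (intro append_in_shuffle_sets) auto
  then have short: "[b] \<in> Q" by simp
  have b_short: "length w \<le> 2" if w: "w \<in> Q" "b \<in> set w" for w
  proof -
    obtain x z where xz: "x \<in> {[], [a]}" "z \<in> R" "length w = length x + length z"
        "set w = set x \<union> set z"
      using w(1) unfolding Q_def by (rule shuffle_setsE)
    then have "b \<in> set z" using w(2) \<open>a \<noteq> b\<close> by auto
    \<comment> \<open>In the probe \<open>b\<close> occurs only as a complete trace, to which the
      unit can add one letter.\<close>
    then have "z = [b]" using xz(2) \<open>a \<noteq> b\<close> by (auto simp: R_def traces_probe)
    then show ?thesis using xz by auto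
  qed
  have letters: "set w \<subseteq> {a, b}" if w: "w \<in> Q" for w
  proof -
    obtain x z where xz: "x \<in> {[], [a]}" "z \<in> R" "length w = length x + length z"
        "set w = set x \<union> set z"
      using w unfolding Q_def by (rule shuffle_setsE)
    then show ?thesis by (auto simp: R_def traces_probe)
  qed
  have long_y: "b # replicate m a \<in> traces (\<tau> y)"
    using longR by (simp add: \<tau>_def traces_Pre R_def)
  have not_var: "y \<notin> vars v" if "traces (subst \<tau> v) \<subseteq> Q" for v
  proof
    assume "y \<in> vars v"
    then obtain w where "w @ b # replicate m a \<in> traces (subst \<tau> v)"
      using long_y by (rule trace_of_var)
    then have "w @ b # replicate m a \<in> Q" using that by (rule rev_subsetD)
    then show False using b_short[of "w @ b # replicate m a"] by (simp add: m_def)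
  qed
  have unchanged: "subst \<tau> v = subst \<sigma> v" if "y \<notin> vars v" for v
    using that by (intro subst_cong) (auto simp: \<tau>_def)
  have small: "length w \<le> size (subst \<sigma> u)"
    if "y \<notin> vars v" "size (subst \<sigma> v) \<le> size (subst \<sigma> u)" "w \<in> traces (subst \<tau> v)" for v w
    using length_trace_le_size[of w "subst \<sigma> v"] unchanged[OF that(1)] that by simp
  have "(b, R) \<in> futures (subst \<tau> (Var y))" by (simp add: \<tau>_def R_def futures_Pre)
  moreover have "futures (subst \<tau> (Var y)) \<subseteq> futures (subst \<tau> t2)"
    by (rule summand_futures) (simp add: Z y(1))
  ultimately have "(b, R) \<in> futures (subst \<tau> t2)" by blast
  \<comment> \<open>As \<open>y\<close> does not occur in \<open>t1\<close>, this factor keeps its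
    unit traces under \<open>\<tau>\<close>.\<close>
  then have "(b, Q) \<in> futures (Par (subst \<tau> t1) (subst \<tau> t2))"
    using in_futures_Par_right[of b R "subst \<tau> t2" "subst \<tau> t1"] unchanged[OF y(2)] t1
    by (simp add: Q_def)
  then have "(b, Q) \<in> futures (subst \<tau> t)"
    using parallel_summand_futures[of \<tau> t t1 t2] par Z by auto
  then have "(b, Q) \<in> futures (subst \<tau> u)" using sound[OF \<tau>] by simp
  then obtain s where s: "s \<in> summands (null_vars \<sigma>) u" "(b, Q) \<in> futures (subst \<tau> s)"
    unfolding futures_subst[of \<tau> u] Z by blast
  have size_s: "size (subst \<sigma> s) \<le> size (subst \<sigma> u)" using s(1) by (rule summand_size)
  \<comment> \<open>The idle factor \<open>w\<close> has its traces in \<open>Q\<close>, so it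
    avoids \<open>y\<close> and is too small for the long trace; thus \<open>X\<close> has a trace
    of length at least two. Appending to it a trace of \<open>w\<close> with \<open>b\<close> would
    violate \<open>b_short\<close>, so the \<open>b\<close> of \<open>[b]\<close> comes from
    \<open>X\<close>. After that, \<open>w\<close> can add at most one letter, which must be
    \<open>a\<close>.\<close>
  have unit: "traces (subst \<sigma> w) = {[], [a]}"
    if fut: "(b, X) \<in> futures (subst \<tau> v)" and Q: "Q = shuffle_sets X (traces (subst \<tau> w))"
      and w: "\<not> null (null_vars \<sigma>) w" "size (subst \<sigma> w) \<le> size (subst \<sigma> u)" for X v w
  proof -
    let ?Y = "traces (subst \<tau> w)"
    have Nil: "[] \<in> X" using fut by (rule Nil_in_future)
    have Y_Q: "?Y \<subseteq> Q"
      using append_in_shuffle_sets[OF Nil, of _ ?Y] Q by auto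
    have yw: "y \<notin> vars w" using Y_Q by (rule not_var)
    have "a # replicate m a \<in> shuffle_sets X ?Y" using long Q by simp
    then obtain x z where xz: "x \<in> X" "z \<in> ?Y" "length (a # replicate m a) = length x + length z"
      by (rule shuffle_setsE)
    have x: "length x \<ge> 2" using xz(3) small[OF yw w(2) xz(2)] by (simp add: m_def)
    have no_b: "b \<notin> set z" if z: "z \<in> ?Y" for z
    proof
      assume "b \<in> set z"
      moreover have "x @ z \<in> Q" using append_in_shuffle_sets[OF xz(1) z] Q by simp
      ultimately have "length x + length z \<le> 2" using b_short[of "x @ z"] by simp
      then show False using x \<open>b \<in> set z\<close> by (cases z) auto
    qed
    have "[b] \<in> shuffle_sets X ?Y" using short Q by simp
    then obtain x' z' where x': "x' \<in> X" "z' \<in> ?Y" "set [b] = set x' \<union> set z'"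
      by (rule shuffle_setsE)
    then have b_x': "b \<in> set x'" using no_b by auto
    have sub: "z \<in> {[], [a]}" if z: "z \<in> ?Y" for z
    proof -
      have "x' @ z \<in> Q" using append_in_shuffle_sets[OF x'(1) z] Q by simp
      then have "length x' + length z \<le> 2" "set z \<subseteq> {a, b}"
        using b_short[of "x' @ z"] letters[of "x' @ z"] b_x' by auto
      then have "length z \<le> 1" "set z \<subseteq> {a}" using b_x' no_b[OF z] by (cases x'; auto)+
      then show ?thesis by (cases z) auto
    qed
    have "?Y \<noteq> {[]}" using w(1) null_iff[of \<tau> w] Z by simp
    then obtain d where "[d] \<in> ?Y" by (rule nonnull_trace)
    then have "?Y = {[], [a]}" using sub[of "[d]"] sub by auto
    then show ?thesis using unchanged[OF yw] by simp
  qed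
  from s(1) show thesis
  proof (cases rule: summand_cases)
    case (Var x)
    show thesis
    proof (cases "x = y")
      case True
      then have "Q = R" using s(2) Var by (simp add: \<tau>_def futures_Pre R_def)
      then show thesis using long boundR by simp
    next
      case False
      then have "b # a # replicate m a \<in> traces (\<sigma> x)"
        using s(2) Var long by (auto simp: Cons_in_traces_iff_futures \<tau>_def)
      then have "length (b # a # replicate m a) \<le> size (\<sigma> x)" by (rule length_trace_le_size)
      then show thesis using size_s Var by (simp add: m_def)
    qed
  next
    case (Pre c v)
    then have v: "traces (subst \<tau> v) = Q" using s(2) by (auto simp: futures_Pre)
    then have "a # replicate m a \<in> traces (subst \<tau> v)" using long by simp
    then have "length (a # replicate m a) \<le> size (subst \<sigma> u)"
      using size_s Pre v not_var[of v] by (intro small[of v]) auto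
    then show thesis by (simp add: m_def)
  next
    case (Par v w)
    then consider X where "(b, X) \<in> futures (subst \<tau> v)" "Q = shuffle_sets X (traces (subst \<tau> w))"
      | X where "(b, X) \<in> futures (subst \<tau> w)" "Q = shuffle_sets X (traces (subst \<tau> v))"
      using s(2) by (auto simp: futures_Par shuffle_sets_commute)
    then show thesis
    proof cases
      case 1
      then show thesis
        using that[of w v] unit[of X v w] Par s(1) size_s by (simp add: parallel_summand_def)
    next
      case 2
      then show thesis
        using that[of v w] unit[of X w v] Par s(1) size_s by (simp add: parallel_summand_def)
    qed
  qed
qed

section \<open>The family of equations\<close>

text \<open>With \<open>Suc i\<close> every branch starts with \<open>a\<close>, so no trace of
  \<open>branches\<close> starts with two \<open>b\<close>. The final \<open>b\<close> marks
  completion of the branch and so fixes \<open>i\<close>.\<close>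

definition branch :: "'a \<Rightarrow> 'a \<Rightarrow> nat \<Rightarrow> ('a, 'v) trm" where
  "branch a b i = foldr Pre (replicate (Suc i) a @ [b]) Zero"

definition branches :: "'a \<Rightarrow> 'a \<Rightarrow> nat \<Rightarrow> ('a, 'v) trm" where
  "branches a b N = foldr Choice (map (\<lambda>i. Pre b (branch a b i)) [0..<N]) Zero"

definition lhs :: "'a \<Rightarrow> 'a \<Rightarrow> nat \<Rightarrow> ('a, 'v) trm" where
  "lhs a b N = Par (Pre a Zero) (branches a b N)"

text \<open>Inert factors such as \<open>Zero\<close> are kept so that the residuals coincide
  syntactically with those of \<open>lhs\<close>.\<close>

definition rhs :: "'a \<Rightarrow> 'a \<Rightarrow> nat \<Rightarrow> ('a, 'v) trm" where
  "rhs a b N = Choice (Pre a (Par Zero (branches a b N)))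
     (foldr Choice (map (\<lambda>i. Pre b (Par (Pre a Zero) (branch a b i))) [0..<N]) Zero)"

lemma step_foldr_Choice:
  "step (foldr Choice ps Zero) c r \<longleftrightarrow> (\<exists>p\<in>set ps. step p c r)"
  by (induction ps) (auto intro: step.intros)

lemma summands_foldr_Choice:
  "summands Z (foldr Choice ps Zero) = (\<Union>p\<in>set ps. summands Z p)"
  by (induction ps) auto

lemma vars_foldr_Choice: "vars (foldr Choice ps Zero) = (\<Union>p\<in>set ps. vars p)"
  by (induction ps) auto

lemma vars_foldr_Pre: "vars (foldr Pre w p) = vars p"
  by (induction w) auto

lemma traces_foldr_Pre: "traces (foldr Pre w Zero) = {v. prefix v w}"
  by (induction w) (auto simp: traces_Pre prefix_Cons)

lemma step_Pre_iff: "step (Pre d p) c r \<longleftrightarrow> c = d \<and> r = p"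
  by (auto intro: step.intros)

lemma step_Choice_iff: "step (Choice p q) c r \<longleftrightarrow> step p c r \<or> step q c r"
  by (auto intro: step.intros)

lemma step_branches_iff:
  "step (branches a b N) c r \<longleftrightarrow> (\<exists>i<N. c = b \<and> r = branch a b i)"
  by (auto simp: branches_def step_foldr_Choice step_Pre_iff)

lemma vars_branch [simp]: "vars (branch a b i) = {}"
  unfolding branch_def vars_foldr_Pre by simp

lemma lhs_closed: "vars (lhs a b N) = {}"
  by (auto simp: lhs_def branches_def vars_foldr_Choice)

lemma rhs_closed: "vars (rhs a b N) = {}"
  by (auto simp: rhs_def branches_def vars_foldr_Choice)

lemma step_lhs_iff_rhs: "step (lhs a b N) c r \<longleftrightarrow> step (rhs a b N) c r"
proof -
  have "step (rhs a b N) c r \<longleftrightarrow> (c = a \<and> r = Par Zero (branches a b N)) \<or>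
      (\<exists>i<N. c = b \<and> r = Par (Pre a Zero) (branch a b i))"
    by (auto simp: rhs_def step_Choice_iff step_foldr_Choice step_Pre_iff)
  moreover have "step (lhs a b N) c r \<longleftrightarrow> (c = a \<and> r = Par Zero (branches a b N)) \<or>
      (\<exists>i<N. c = b \<and> r = Par (Pre a Zero) (branch a b i))"
    by (auto simp: lhs_def step_Par_iff step_branches_iff step_Pre_iff)
  ultimately show ?thesis by blast
qed

lemma traces_unit: "traces (Pre a Zero) = {[], [a]}"
  by (simp add: traces_Pre)

lemma futures_lhs:
  "futures (lhs a b N :: ('a, 'v) trm) = insert (a, traces (branches a b N :: ('a, 'v) trm))
    {(b, shuffle_sets {[], [a]} (traces (branch a b i :: ('a, 'v) trm))) |i. i < N}"
proof -
  have "futures (branches a b N :: ('a, 'v) trm) =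
      {(b, traces (branch a b i :: ('a, 'v) trm)) |i. i < N}"
    by (auto simp: futures_def step_branches_iff)
  then show ?thesis
    by (auto simp: lhs_def futures_Par futures_Pre traces_unit)
qed

lemma Cons_in_traces_branches:
  "c # w \<in> traces (branches a b N) \<longleftrightarrow> c = b \<and> (\<exists>i<N. prefix w (replicate (Suc i) a @ [b]))"
  by (auto simp: Cons_in_traces_iff step_branches_iff branch_def traces_foldr_Pre
      simp del: replicate_Suc foldr_append foldr_replicate)

text \<open>The trailing \<^term>\<open>a\<close> after \<^term>\<open>b\<close> must come from the unit process, so the trace
  pins down the branch.\<close>

lemma branch_unique:
  assumes X: "shuffle_sets {[], [a]} X = shuffle_sets {[], [a]} (traces (branch a b j :: ('a, 'v) trm))"
    and i: "replicate (Suc i) a @ [b] \<in> X" and "a \<noteq> b"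
  shows "i = j"
proof -
  let ?w = "(replicate (Suc i) a @ [b]) @ [a]"
  have "?w \<in> shuffle_sets {[], [a]} X" using i by (intro append_in_shuffle_sets') auto
  then have "?w \<in> shuffle_sets {[], [a]} (traces (branch a b j :: ('a, 'v) trm))"
    unfolding X .
  then obtain x z where xz: "x \<in> {[], [a]}" "z \<in> traces (branch a b j :: ('a, 'v) trm)" "?w \<in> shuffles x z"
      "length ?w = length x + length z" "set ?w = set x \<union> set z"
    by (rule shuffle_setsE)
  \<comment> \<open>The unit contributes no \<open>b\<close>, so \<open>z\<close> does, and a prefix
    reaching the final \<open>b\<close> is the whole trace.\<close>
  have "b \<in> set z" using xz(1,5) \<open>a \<noteq> b\<close> by auto
  moreover have "prefix z (replicate (Suc j) a @ [b])"
    using xz(2) unfolding branch_def traces_foldr_Pre by simp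
  moreover have "b \<notin> set z" if "prefix z (replicate (Suc j) a)"
    using set_mono_prefix[OF that] \<open>a \<noteq> b\<close> by auto
  ultimately have z: "z = replicate (Suc j) a @ [b]"
    unfolding prefix_snoc by blast
  \<comment> \<open>The shuffled trace ends in \<open>a\<close> but \<open>z\<close> ends in
    \<open>b\<close>. So \<open>x\<close> is \<open>[a]\<close>, and comparing lengths gives
    \<open>i = j\<close>.\<close>
  have "x \<noteq> []"
  proof
    assume "x = []"
    then have "?w = z" using xz(3) by (simp only: shuffles.simps singleton_iff)
    then have "last ?w = last z" by (rule arg_cong)
    then show False using z \<open>a \<noteq> b\<close> by simp
  qed
  then show ?thesis using xz(1,4) z by auto
qed

section \<open>The invariant\<close>

text \<open>The property that separates \<open>lhs\<close> from \<open>rhs\<close>. It constrains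
  the factors only by their trace sets, so rewriting inside a factor by sound equations cannot
  change it.\<close>

definition witness :: "'a \<Rightarrow> 'a \<Rightarrow> nat \<Rightarrow> ('a, 'v) trm \<Rightarrow> bool" where
  "witness a b N p \<longleftrightarrow> (\<exists>p1 p2. parallel_summand UNIV p p1 p2 \<and>
     traces p1 = {[], [a]} \<and> traces p2 = traces (branches a b N :: ('a, 'v) trm))"

text \<open>A term with fewer summands than there are branches cannot produce each branch by a prefix
  of its own, and no prefix serves two branches.\<close>

lemma Var_summand_exists:
  fixes t :: "('a, 'v) trm"
  assumes par: "parallel_summand (null_vars \<sigma>) t t1 t2"
    and t1: "traces (subst \<sigma> t1) = {[], [a]}"
    and t2: "traces (subst \<sigma> t2) = traces (branches a b N :: ('a, 'v) trm)"
    and fut: "futures (subst \<sigma> t) \<subseteq> futures (lhs a b N :: ('a, 'v) trm)"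
    and card: "card (summands (null_vars \<sigma>) t2) < N" and "a \<noteq> b"
  obtains y where "Var y \<in> summands (null_vars \<sigma>) t2"
proof (rule ccontr)
  assume "\<not> thesis"
  then have no_var: "Var y \<notin> summands (null_vars \<sigma>) t2" for y using that by blast
  let ?S = "summands (null_vars \<sigma>) t2"
  let ?w = "\<lambda>i. replicate (Suc i) a @ [b]"
  have "\<exists>v. Pre b v \<in> ?S \<and> ?w i \<in> traces (subst \<sigma> v)" if "i < N" for i
  proof -
    have "b # ?w i \<in> traces (subst \<sigma> t2)"
      unfolding t2 Cons_in_traces_branches using that by auto
    then obtain X where X: "(b, X) \<in> futures (subst \<sigma> t2)" "?w i \<in> X"
      unfolding Cons_in_traces_iff_futures by blast
    then obtain s where s: "s \<in> ?S" "(b, X) \<in> futures (subst \<sigma> s)"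
      unfolding futures_subst[of \<sigma> t2] by blast
    from s(1) show ?thesis
    proof (cases rule: summand_cases)
      case (Var x)
      then show ?thesis using s(1) no_var by simp
    next
      case (Pre c v)
      then show ?thesis using s X(2) by (auto simp: futures_Pre)
    next
      case (Par v w)
      \<comment> \<open>Initial actions of two nonnull factors can occur in either order, but a
        two-letter trace of \<open>branches\<close> is \<open>b\<close> followed by
        \<open>a\<close>.\<close>
      obtain c where c: "[c] \<in> traces (subst \<sigma> v)"
        using Par(2) nonnull_trace by (metis null_iff)
      obtain d where d: "[d] \<in> traces (subst \<sigma> w)"
        using Par(3) nonnull_trace by (metis null_iff)
      have sub: "traces (subst \<sigma> s) \<subseteq> traces (branches a b N :: ('a, 'v) trm)"
        using futures_subset_traces[OF summand_futures[OF s(1)]] t2 by simp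
      have "[c, d] \<in> traces (subst \<sigma> s)" "[d, c] \<in> traces (subst \<sigma> s)"
        using append_in_shuffle_sets[OF c d] append_in_shuffle_sets'[OF c d] Par
        by (simp_all add: traces_Par)
      then have "[c, d] \<in> traces (branches a b N :: ('a, 'v) trm)"
        "[d, c] \<in> traces (branches a b N :: ('a, 'v) trm)" using sub by blast+
      then show ?thesis using \<open>a \<noteq> b\<close> by (auto simp: Cons_in_traces_branches)
    qed
  qed
  then obtain f where f: "\<And>i. i < N \<Longrightarrow> Pre b (f i) \<in> ?S \<and> ?w i \<in> traces (subst \<sigma> (f i))"
    by metis
  have "inj_on (\<lambda>i. Pre b (f i)) {..<N}"
  proof (rule inj_onI)
    fix i j assume ij: "i \<in> {..<N}" "j \<in> {..<N}" "Pre b (f i) = Pre b (f j)"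
    \<comment> \<open>Next to the unit \<open>t1\<close>, the residual of this prefix must match the
      residual of a single branch \<open>k\<close> of \<open>lhs\<close>; a prefix shared by
      \<open>i\<close> and \<open>j\<close> then forces both to equal \<open>k\<close>.\<close>
    have "(b, traces (subst \<sigma> (f i))) \<in> futures (subst \<sigma> t2)"
      using summand_futures[of "Pre b (f i)" \<sigma> t2] f[of i] ij(1) by (auto simp: futures_Pre)
    then have "(b, shuffle_sets {[], [a]} (traces (subst \<sigma> (f i)))) \<in>
        futures (lhs a b N :: ('a, 'v) trm)"
      using in_futures_Par_right[of b _ "subst \<sigma> t2" "subst \<sigma> t1"] t1
        parallel_summand_futures[OF par] fut by auto
    then obtain k where k: "shuffle_sets {[], [a]} (traces (subst \<sigma> (f i))) =
        shuffle_sets {[], [a]} (traces (branch a b k :: ('a, 'v) trm))"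
      using \<open>a \<noteq> b\<close> by (auto simp: futures_lhs)
    have "i = k" using f[of i] ij(1) by (intro branch_unique[OF k _ \<open>a \<noteq> b\<close>]) auto
    moreover have "j = k" using f[of j] ij(2,3) by (intro branch_unique[OF k _ \<open>a \<noteq> b\<close>]) auto
    ultimately show "i = j" by simp
  qed
  then have "card {..<N} \<le> card ?S"
    using f by (intro card_inj_on_le[where f = "\<lambda>i. Pre b (f i)"]) auto
  then show False using card by simp
qed

lemma summand_size_le: "s \<in> summands Z t \<Longrightarrow> size s \<le> size t"
  by (induction t) (auto split: if_splits)

lemma parallel_summand_size: "parallel_summand Z t t1 t2 \<Longrightarrow> size t2 < size t"
  unfolding parallel_summand_def
  using summand_size_le[of "Par t1 t2" Z t] summand_size_le[of "Par t2 t1" Z t] by auto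

text \<open>A parallel summand of an instance is either contributed by the value of a variable
  summand or already visible in the open term. The transfer of witnesses splits on this.\<close>

lemma parallel_summand_subst:
  assumes "parallel_summand UNIV (subst \<sigma> t) p q"
  obtains (Var) x where "Var x \<in> summands (null_vars \<sigma>) t" "parallel_summand UNIV (\<sigma> x) p q"
    | (Par) t1 t2 where "parallel_summand (null_vars \<sigma>) t t1 t2" "p = subst \<sigma> t1" "q = subst \<sigma> t2"
proof -
  obtain r where r: "r \<in> summands UNIV (subst \<sigma> t)" "r = Par p q \<or> r = Par q p"
    using assms by (auto simp: parallel_summand_def)
  then obtain s where s: "s \<in> summands (null_vars \<sigma>) t"
      "r \<in> (case s of Var x \<Rightarrow> summands UNIV (\<sigma> x) | _ \<Rightarrow> {subst \<sigma> s})"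
    unfolding summands_subst by blast
  from s(1) show thesis
  proof (cases rule: summand_cases)
    case (Var x)
    then show thesis using that(1)[of x] s r by (auto simp: parallel_summand_def)
  next
    case (Pre c v)
    then show thesis using s r by auto
  next
    case (Par v w)
    then show thesis
      using that(2)[of v w] that(2)[of w v] s r by (auto simp: parallel_summand_def)
  qed
qed

lemma parallel_summand_substI:
  assumes "parallel_summand (null_vars \<sigma>) t u v"
  shows "parallel_summand UNIV (subst \<sigma> t) (subst \<sigma> u) (subst \<sigma> v)"
  using assms unfolding parallel_summand_def summands_subst by force

lemma parallel_summand_VarI:
  assumes "Var x \<in> summands (null_vars \<sigma>) t" "parallel_summand UNIV (\<sigma> x) p q"
  shows "parallel_summand UNIV (subst \<sigma> t) p q"
  using assms unfolding parallel_summand_def summands_subst by force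

lemma witness_transfer:
  fixes t u :: "('a, 'v) trm" and \<sigma> :: "'v \<Rightarrow> ('a, 'v) trm" and a b :: 'a
  assumes sound: "\<And>\<sigma>. closed_subst \<sigma> \<Longrightarrow> futures (subst \<sigma> t) = futures (subst \<sigma> u)"
    and \<sigma>: "closed_subst \<sigma>" and fut: "futures (subst \<sigma> t) \<subseteq> futures (lhs a b N :: ('a, 'v) trm)"
    and size: "size t < N" and "a \<noteq> b" and wit: "witness a b N (subst \<sigma> t)"
  shows "witness a b N (subst \<sigma> u)"
proof -
  let ?B = "branches a b N :: ('a, 'v) trm"
  obtain p q where pq: "parallel_summand UNIV (subst \<sigma> t) p q"
      "traces p = {[], [a]}" "traces q = traces ?B"
    using wit by (auto simp: witness_def)
  from pq(1) show ?thesis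
  proof (cases rule: parallel_summand_subst)
    case (Var x)
    have "Var x \<in> summands (null_vars \<sigma>) u"
      using Var_summand_transfer[OF sound \<sigma> Var(1) \<open>a \<noteq> b\<close>] .
    then have "parallel_summand UNIV (subst \<sigma> u) p q"
      using Var(2) by (rule parallel_summand_VarI)
    then show ?thesis using pq(2,3) unfolding witness_def by (intro exI conjI)
  next
    case (Par t1 t2)
    have t1: "traces (subst \<sigma> t1) = {[], [a]}" and t2: "traces (subst \<sigma> t2) = traces ?B"
      using Par pq by simp_all
    \<comment> \<open>A proper factor is strictly smaller than \<open>t\<close>, which absorbs the
      extra one in the bound on summands.\<close>
    have "card (summands (null_vars \<sigma>) t2) < N"
      using card_summands_le_size[of "null_vars \<sigma>" t2] parallel_summand_size[OF Par(1)] size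
      by linarith
    with Par(1) t1 t2 fut obtain y where y: "Var y \<in> summands (null_vars \<sigma>) t2"
      using \<open>a \<noteq> b\<close> by (rule Var_summand_exists)
    \<comment> \<open>As a summand of \<open>t2\<close>, the variable \<open>y\<close> can start
      only with \<open>b\<close>, an action that \<open>t1\<close> never performs.\<close>
    have y_t1: "y \<notin> vars t1"
    proof
      assume "y \<in> vars t1"
      have "traces (\<sigma> y) \<noteq> {[]}" using summand_Var[OF y] by (simp add: null_vars_def)
      then obtain c where c: "[c] \<in> traces (\<sigma> y)" by (rule nonnull_trace)
      have "[c] \<in> traces (subst \<sigma> t2)"
        using futures_subset_traces[OF summand_futures[OF y]] c by auto
      then have "c = b" using t2 Cons_in_traces_branches by metis
      obtain w where "w @ [c] \<in> traces (subst \<sigma> t1)"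
        using \<open>y \<in> vars t1\<close> c by (rule trace_of_var)
      then show False using t1 \<open>c = b\<close> \<open>a \<noteq> b\<close> by auto
    qed
    obtain u1 u2 where u: "parallel_summand (null_vars \<sigma>) u u1 u2"
        "traces (subst \<sigma> u1) = {[], [a]}"
      using Par_summand_transfer[OF sound \<sigma> Par(1) t1 y y_t1 \<open>a \<noteq> b\<close>] .
    \<comment> \<open>Once the unit factor has performed \<open>a\<close>, exactly the traces of
      \<open>u2\<close> remain; the only future of \<open>lhs\<close> by \<open>a\<close> identifies
      them with those of \<open>branches\<close>.\<close>
    have "[a] \<in> traces (subst \<sigma> u1)" using u(2) by simp
    then obtain X where X: "(a, X) \<in> futures (subst \<sigma> u1)"
      unfolding Cons_in_traces_iff_futures by blast
    have "X = {[]}"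
    proof -
      have "w = []" if "w \<in> X" for w
      proof -
        have "a # w \<in> traces (subst \<sigma> u1)" using X that Cons_in_traces_iff_futures by metis
        then show ?thesis using u(2) by simp
      qed
      then show ?thesis using Nil_in_future[OF X] by blast
    qed
    then have "(a, traces (subst \<sigma> u2)) \<in> futures (Par (subst \<sigma> u1) (subst \<sigma> u2))"
      using in_futures_Par_left[OF X, of "subst \<sigma> u2"] by simp
    then have "(a, traces (subst \<sigma> u2)) \<in> futures (lhs a b N :: ('a, 'v) trm)"
      using parallel_summand_futures[OF u(1)] sound[OF \<sigma>] fut by blast
    then have "traces (subst \<sigma> u2) = traces ?B" using \<open>a \<noteq> b\<close> by (auto simp: futures_lhs)
    with parallel_summand_substI[OF u(1)] u(2) show ?thesis
      unfolding witness_def by (intro exI conjI)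
  qed
qed

lemma witness_Choice: "witness a b N (Choice p q) \<longleftrightarrow> witness a b N p \<or> witness a b N q"
  by (auto simp: witness_def parallel_summand_def)

text \<open>Two nonnull factors form a single summand, so only their traces matter; otherwise the
  composition inherits the summands of one factor.\<close>

lemma witness_Par:
  fixes p q :: "('a, 'v) trm"
  shows "witness a b N (Par p q) \<longleftrightarrow>
    (if traces q = {[]} then witness a b N p else if traces p = {[]} then witness a b N q
     else let B = traces (branches a b N :: ('a, 'v) trm) in
       traces p = {[], [a]} \<and> traces q = B \<or> traces q = {[], [a]} \<and> traces p = B)"
  by (auto simp: witness_def parallel_summand_def null_UNIV_iff Let_def)

text \<open>The size bound concerns the open axioms, not their instances. All closed substitutions
  are treated at once, so that the instance rule just composes substitutions. The condition on
  futures passes along an equation and down to the components of a choice.\<close>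

lemma derives_invariant:
  fixes E :: "('a, 'v) trm rel" and a b :: 'a
  assumes sound: "\<And>t u \<sigma>. (t, u) \<in> E \<Longrightarrow> closed_subst \<sigma> \<Longrightarrow> futures (subst \<sigma> t) = futures (subst \<sigma> u)"
    and size: "\<And>t u. (t, u) \<in> E \<Longrightarrow> size t < N \<and> size u < N" and "a \<noteq> b"
  shows "derives E t u \<Longrightarrow> closed_subst \<sigma> \<Longrightarrow> futures (subst \<sigma> t) = futures (subst \<sigma> u) \<and>
    (futures (subst \<sigma> t) \<subseteq> futures (lhs a b N :: ('a, 'v) trm) \<longrightarrow>
      witness a b N (subst \<sigma> t) = witness a b N (subst \<sigma> u))"
proof (induction arbitrary: \<sigma> rule: derives.induct)
  case (ax t u)
  have "witness a b N (subst \<sigma> t) = witness a b N (subst \<sigma> u)"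
    if fut: "futures (subst \<sigma> t) \<subseteq> futures (lhs a b N :: ('a, 'v) trm)"
  proof
    show "witness a b N (subst \<sigma> t) \<Longrightarrow> witness a b N (subst \<sigma> u)"
      using witness_transfer[OF sound[OF ax(1)] ax(2) fut] size[OF ax(1)] \<open>a \<noteq> b\<close> by blast
    have fut': "futures (subst \<sigma> u) \<subseteq> futures (lhs a b N :: ('a, 'v) trm)"
      using fut sound[OF ax] by simp
    show "witness a b N (subst \<sigma> u) \<Longrightarrow> witness a b N (subst \<sigma> t)"
      using witness_transfer[OF sound[OF ax(1), symmetric] ax(2) fut'] size[OF ax(1)] \<open>a \<noteq> b\<close>
      by blast
  qed
  then show ?case using sound[OF ax] by simp
next
  case (inst t u \<tau>)
  have "closed_subst (\<lambda>x. subst \<sigma> (\<tau> x))"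
    unfolding closed_subst_def processes_def using vars_subst_closed[OF inst.prems] by simp
  then show ?case using inst.IH by (simp add: subst_subst)
next
  case (cong_pre t u c)
  have "traces (subst \<sigma> t) = traces (subst \<sigma> u)"
    using cong_pre.IH[OF cong_pre.prems] traces_eqI by blast
  \<comment> \<open>A prefix is its own only summand, so neither side has a witness.\<close>
  then show ?case by (simp add: futures_Pre witness_def parallel_summand_def)
next
  case (cong_choice t u t' u')
  then show ?case by (simp add: futures_Choice witness_Choice)
next
  case (cong_par t u t' u')
  note IH = cong_par.IH(1)[OF cong_par.prems] cong_par.IH(2)[OF cong_par.prems]
  have tr: "traces (subst \<sigma> t) = traces (subst \<sigma> u)" "traces (subst \<sigma> t') = traces (subst \<sigma> u')"
    using IH traces_eqI by blast+
  have "futures (subst \<sigma> (Par t t')) = futures (subst \<sigma> (Par u u'))"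
    using IH tr by (simp add: futures_Par)
  moreover have "witness a b N (subst \<sigma> (Par t t')) = witness a b N (subst \<sigma> (Par u u'))"
    if fut: "futures (subst \<sigma> (Par t t')) \<subseteq> futures (lhs a b N :: ('a, 'v) trm)"
  \<comment> \<open>With a null factor the composition has the futures of the other one, so the
    induction hypothesis applies to it; with none, equal traces of the factors decide.\<close>
  proof (cases "traces (subst \<sigma> t') = {[]}")
    case True
    then show ?thesis using IH tr fut by (simp add: witness_Par futures_Par_null)
  next
    case False
    then show ?thesis using IH tr fut
      by (cases "traces (subst \<sigma> t) = {[]}") (simp_all add: witness_Par futures_Par_null)
  qed
  ultimately show ?case by blast
qed auto

lemma subst_closed: "vars p = {} \<Longrightarrow> subst \<sigma> p = p"
  by (induction p) auto

lemma witness_lhs: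
  assumes "0 < N"
  shows "witness a b N (lhs a b N :: ('a, 'v) trm)"
proof -
  have "[b] \<in> traces (branches a b N :: ('a, 'v) trm)"
    unfolding Cons_in_traces_branches using assms by auto
  then have "traces (branches a b N :: ('a, 'v) trm) \<noteq> {[]}" by auto
  then show ?thesis by (simp add: lhs_def witness_Par traces_unit)
qed

text \<open>All summands of \<open>rhs\<close> are prefixes.\<close>

lemma not_witness_rhs: "\<not> witness a b N (rhs a b N)"
  by (simp add: rhs_def witness_def parallel_summand_def summands_foldr_Choice)

text \<open>Handles both equivalences together: it covers any relation that identifies processes
  with the same transitions and never identifies processes with different futures.\<close>

theorem no_finite_ground_complete_axiomatisation:
  fixes R :: "('a, 'v) trm rel" and a b :: 'a
  assumes "a \<noteq> b"
    and sound: "\<And>p q. (p, q) \<in> R \<Longrightarrow> futures p = futures q"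
    and R: "\<And>p q. p \<in> processes \<Longrightarrow> q \<in> processes \<Longrightarrow> (\<And>c r. step p c r \<longleftrightarrow> step q c r) \<Longrightarrow> (p, q) \<in> R"
  shows "\<not> finite_ground_complete_axiomatisation E R"
proof
  assume E: "finite_ground_complete_axiomatisation E R"
  then have "finite (size ` (fst ` E \<union> snd ` E))"
    by (simp add: finite_ground_complete_axiomatisation_def)
  then obtain N where N: "\<forall>k \<in> size ` (fst ` E \<union> snd ` E). k < N"
    unfolding finite_nat_set_iff_bounded by blast
  \<comment> \<open>The successor guarantees at least one branch even when \<open>E\<close> is
    empty.\<close>
  define M where "M = Suc N"
  have size: "size t < M \<and> size u < M" if "(t, u) \<in> E" for t u
    using N that by (force simp: M_def)
  have E_sound: "futures (subst \<sigma> t) = futures (subst \<sigma> u)" if "(t, u) \<in> E" "closed_subst \<sigma>" for t u \<sigma>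
    using E that sound
    unfolding finite_ground_complete_axiomatisation_def sound_modulo_def by blast
  let ?l = "lhs a b M :: ('a, 'v) trm" and ?r = "rhs a b M :: ('a, 'v) trm"
  have closed: "?l \<in> processes" "?r \<in> processes"
    by (simp_all add: processes_def lhs_closed rhs_closed)
  have "(?l, ?r) \<in> R" using closed step_lhs_iff_rhs by (rule R)
  then have "derives E ?l ?r"
    using E closed by (simp add: finite_ground_complete_axiomatisation_def ground_complete_def)
  \<comment> \<open>Any closed substitution would do, since it leaves the two closed sides
    unchanged.\<close>
  moreover have "closed_subst (\<lambda>_. Zero :: ('a, 'v) trm)"
    by (simp add: closed_subst_def processes_def)
  ultimately have "futures ?l \<subseteq> futures ?l \<longrightarrow> witness a b M ?l = witness a b M ?r"
    using derives_invariant[of E M a b ?l ?r "\<lambda>_. Zero"] E_sound size \<open>a \<noteq> b\<close>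
    by (simp add: subst_closed lhs_closed rhs_closed)
  moreover have "witness a b M ?l" by (rule witness_lhs) (simp add: M_def)
  moreover have "\<not> witness a b M ?r" by (rule not_witness_rhs)
  ultimately show False by blast
qed

theorem theorem6p15:
  fixes n :: nat
  assumes "card (UNIV :: 'a::finite set) \<ge> 2"
    and "n \<ge> 2"
  shows "\<not> (\<exists>E :: ('a, 'v::{countable, infinite}) trm rel.
            finite_ground_complete_axiomatisation E (nested_trace_equiv n))
       \<and> \<not> (\<exists>E :: ('a, 'v) trm rel.
            finite_ground_complete_axiomatisation E (nested_sim_equiv n))"
proof -
  obtain a b :: 'a where "a \<noteq> b"
    using assms(1) card_2_iff' by (metis card_le_Suc0_iff_eq finite not_less_eq_eq numeral_2_eq_2 UNIV_I)
  obtain k where n: "n = Suc (Suc k)"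
    using assms(2) by (metis add_2_eq_Suc le_Suc_ex)
  have "\<not> finite_ground_complete_axiomatisation E (nested_trace_equiv n)"
    for E :: "('a, 'v) trm rel"
    using \<open>a \<noteq> b\<close>
    by (rule no_finite_ground_complete_axiomatisation)
       (use n nested_trace_equiv_futures in blast, rule nested_trace_equivI)
  moreover have "\<not> finite_ground_complete_axiomatisation E (nested_sim_equiv n)"
    for E :: "('a, 'v) trm rel"
    using \<open>a \<noteq> b\<close>
    by (rule no_finite_ground_complete_axiomatisation)
       (use n nested_sim_equiv_futures in blast, rule nested_sim_equivI)
  ultimately show ?thesis by blast
qed

end
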